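(* Let $\mathbf{M}$ be a variety of universal algebras that satisfies the congruence extension property (CEP). If $B_1\in\mathbf{M}$ is complete (closed to simple extensions) in $\mathbf{M}$, then $B_1$ is injective in $\mathbf{M}$.
   Context: $\mathbf{M}$ is a variety (equational class) of universal algebras (with finitary operations); all algebras below belong to $\mathbf{M}$. $A\le B$ means that $A$ is a subalgebra of $B$. An algebra $Q\in\mathbf{M}$ is injective in $\mathbf{M}$ if for every $B\in\mathbf{M}$, every subalgebra $A\le B$ and every homomorphism $f:A\to Q$ there is a homomorphism $g:B\to Q$ with $g|_A=f$. A class $K$ of algebras satisfies CEP if for all $B\in K$ and all subalgebras $A\le B$ with $A\in K$, every congruence on $A$ is the restriction to $A$ of some congruence on $B$. For a set $S$, $W(S)$ is the free algebra in $\mathbf{M}$ on $S$; its elements are classes $[w]$ of words (terms) $w$ over $S$. The underlying set of an algebra is used as a set of free generators without its operations, and $W(A)$ is regarded as a subalgebra of $W(A\cup\{a\})$. An algebra $A'\in\mathbf{M}$ is a simple extension of $A$ with element $a$ (possibly $a\in A$), written $A'=A\sqcup a$, if $A\le A'$ and $A\cup\{a\}$ generates $A'$. $Val_A:W(A)\to A$ and $Val_{A\sqcup a}:W(A\cup\{a\})\to A\sqcup a$ are the surjective homomorphisms extending the identity maps on $A$ and on $A\cup\{a\}$ respectively; $Ker_A$ and $Ker_{A\sqcup a}$ are their kernel congruences. The set of $a$-extension conditions for $A$ (given by $A\sqcup a$) is $Ker_{A\sqcup a}|_a := Ker_{A\sqcup a}\setminus Ker_A$. If $B\le B_1$ and $B\sqcup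 x$ is a simple extension of $B$, an element $b\in B_1$ satisfies the $x$-extension conditions $Ker_{B\sqcup x}|_x$ if $w(b)=w'(b)$ in $B_1$ for every $([w(x)],[w'(x)])\in Ker_{B\sqcup x}|_x$, where $w(b)$ is the value in $B_1$ of the word $w$ when each letter from $B$ is interpreted as itself and $x$ is interpreted as $b$. $B_1\in\mathbf{M}$ is complete (closed to simple extensions) in $\mathbf{M}$ if for each subalgebra $B\le B_1$ and each set of $x$-extension conditions $Ker_{B\sqcup x}|_x$ for $B$ (that is, for each simple extension $B\sqcup x\in\mathbf{M}$) there is $b\in B_1$ satisfying these conditions. *)

theory Defs
  imports Main
begin

section \<open>Algebras and terms\<close>

text \<open>A signature is a set of operation symbols with their (finite) arities; operations take
  their arguments as a list.\<close>

type_synonym 'f signature = "('f \<times> nat) set"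

record ('f, 'a) algebra =
  carrier :: "'a set"
  opn :: "'f \<Rightarrow> 'a list \<Rightarrow> 'a"

definition is_algebra :: "'f signature \<Rightarrow> ('f, 'a) algebra \<Rightarrow> bool" where
  "is_algebra F A \<longleftrightarrow>
     (\<forall>(f, n) \<in> F. \<forall>xs. length xs = n \<and> set xs \<subseteq> carrier A \<longrightarrow> opn A f xs \<in> carrier A)"

definition subalgebra :: "'f signature \<Rightarrow> ('f, 'a) algebra \<Rightarrow> ('f, 'a) algebra \<Rightarrow> bool" where
  "subalgebra F A B \<longleftrightarrow>
     is_algebra F A \<and> is_algebra F B \<and> carrier A \<subseteq> carrier B \<and>
     (\<forall>(f, n) \<in> F. \<forall>xs. length xs = n \<and> set xs \<subseteq> carrier A \<longrightarrow> opn A f xs = opn B f xs)"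

definition hom :: "'f signature \<Rightarrow> ('f, 'a) algebra \<Rightarrow> ('f, 'b) algebra \<Rightarrow> ('a \<Rightarrow> 'b) \<Rightarrow> bool" where
  "hom F A B h \<longleftrightarrow>
     h ` carrier A \<subseteq> carrier B \<and>
     (\<forall>(f, n) \<in> F. \<forall>xs. length xs = n \<and> set xs \<subseteq> carrier A \<longrightarrow>
        h (opn A f xs) = opn B f (map h xs))"

definition congruence :: "'f signature \<Rightarrow> ('f, 'a) algebra \<Rightarrow> ('a \<times> 'a) set \<Rightarrow> bool" where
  "congruence F A \<theta> \<longleftrightarrow>
     equiv (carrier A) \<theta> \<and>
     (\<forall>(f, n) \<in> F. \<forall>xs ys. length xs = n \<and> list_all2 (\<lambda>x y. (x, y) \<in> \<theta>) xs ys \<longrightarrow>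
        (opn A f xs, opn A f ys) \<in> \<theta>)"

definition generates :: "'f signature \<Rightarrow> ('f, 'a) algebra \<Rightarrow> 'a set \<Rightarrow> bool" where
  "generates F A X \<longleftrightarrow>
     X \<subseteq> carrier A \<and>
     (\<forall>B. subalgebra F B A \<and> X \<subseteq> carrier B \<longrightarrow> carrier B = carrier A)"

datatype ('f, 'v) trm = Var 'v | Op 'f "('f, 'v) trm list"

inductive_set words :: "'f signature \<Rightarrow> 'v set \<Rightarrow> ('f, 'v) trm set" for F S where
  Var: "v \<in> S \<Longrightarrow> Var v \<in> words F S"
| Op: "(f, length ts) \<in> F \<Longrightarrow> \<forall>t \<in> set ts. t \<in> words F S \<Longrightarrow> Op f ts \<in> words F S"

primrec eval :: "('f, 'a) algebra \<Rightarrow> ('v \<Rightarrow> 'a) \<Rightarrow> ('f, 'v) trm \<Rightarrow> 'a" where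
  "eval A \<rho> (Var v) = \<rho> v"
| "eval A \<rho> (Op f ts) = opn A f (map (eval A \<rho>) ts)"

primrec subst :: "('v \<Rightarrow> ('f, 'w) trm) \<Rightarrow> ('f, 'v) trm \<Rightarrow> ('f, 'w) trm" where
  "subst \<sigma> (Var v) = \<sigma> v"
| "subst \<sigma> (Op f ts) = Op f (map (subst \<sigma>) ts)"


section \<open>Varieties\<close>

text \<open>The flag records whether the empty set counts as an algebra (possible only if there are no
  constants), a point on which conventions differ.\<close>

record 'f variety =
  sig :: "'f signature"
  eqs :: "(('f, nat) trm \<times> ('f, nat) trm) set"
  allow_empty :: bool

definition is_variety :: "'f variety \<Rightarrow> bool" where
  "is_variety M \<longleftrightarrow> eqs M \<subseteq> words (sig M) UNIV \<times> words (sig M) UNIV"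

definition algebras :: "'f variety \<Rightarrow> ('f, 'a) algebra set" where
  "algebras M = {A. is_algebra (sig M) A \<and>
     (\<forall>(l, r) \<in> eqs M. \<forall>\<rho>. range \<rho> \<subseteq> carrier A \<longrightarrow> eval A \<rho> l = eval A \<rho> r) \<and>
     (carrier A = {} \<longrightarrow> allow_empty M)}"

definition CEP :: "'f signature \<Rightarrow> ('f, 'a) algebra set \<Rightarrow> bool" where
  "CEP F K \<longleftrightarrow>
     (\<forall>B \<in> K. \<forall>A \<in> K. subalgebra F A B \<longrightarrow>
        (\<forall>\<theta>. congruence F A \<theta> \<longrightarrow>
           (\<exists>\<phi>. congruence F B \<phi> \<and> \<theta> = \<phi> \<inter> (carrier A \<times> carrier A))))"

text \<open>The type argument is the type of the elements of the test algebras; HOL cannot quantify over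
  it inside a formula.\<close>

definition injective :: "'c itself \<Rightarrow> 'f variety \<Rightarrow> ('f, 'b) algebra \<Rightarrow> bool" where
  "injective (_ :: 'c itself) M Q \<longleftrightarrow>
     Q \<in> algebras M \<and>
     (\<forall>B \<in> (algebras M :: ('f, 'c) algebra set). \<forall>A \<in> algebras M. subalgebra (sig M) A B \<longrightarrow>
        (\<forall>f. hom (sig M) A Q f \<longrightarrow>
           (\<exists>g. hom (sig M) B Q g \<and> (\<forall>x \<in> carrier A. g x = f x))))"


section \<open>Free algebras and valuations\<close>

text \<open>Equality of words in the free algebra: the least congruence on the words over S that contains
  all instances, by words over S, of the defining equations.\<close>

inductive_set free_eq :: "'f variety \<Rightarrow> 'v set \<Rightarrow> (('f, 'v) trm \<times> ('f, 'v) trm) set" for M S where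
  ax: "(l, r) \<in> eqs M \<Longrightarrow> range \<sigma> \<subseteq> words (sig M) S \<Longrightarrow> (subst \<sigma> l, subst \<sigma> r) \<in> free_eq M S"
| refl: "t \<in> words (sig M) S \<Longrightarrow> (t, t) \<in> free_eq M S"
| sym: "(s, t) \<in> free_eq M S \<Longrightarrow> (t, s) \<in> free_eq M S"
| trans: "(s, t) \<in> free_eq M S \<Longrightarrow> (t, u) \<in> free_eq M S \<Longrightarrow> (s, u) \<in> free_eq M S"
| cong: "(f, length ss) \<in> sig M \<Longrightarrow> list_all2 (\<lambda>s t. (s, t) \<in> free_eq M S) ss ts \<Longrightarrow>
    (Op f ss, Op f ts) \<in> free_eq M S"

definition cls :: "'f variety \<Rightarrow> 'v set \<Rightarrow> ('f, 'v) trm \<Rightarrow> ('f, 'v) trm set" where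
  "cls M S w = free_eq M S `` {w}"

definition W :: "'f variety \<Rightarrow> 'v set \<Rightarrow> ('f, ('f, 'v) trm set) algebra" where
  "W M S = \<lparr>carrier = words (sig M) S // free_eq M S,
            opn = \<lambda>f ps. cls M S (Op f (map (\<lambda>p. SOME w. w \<in> p) ps))\<rparr>"

text \<open>The inclusion of \<open>W M S\<close> into \<open>W M S'\<close> for \<open>S \<subseteq> S'\<close>: it sends the class of a word over S to
  the class of the same word over S'.\<close>

definition W_incl :: "'f variety \<Rightarrow> 'v set \<Rightarrow> ('f, 'v) trm set \<Rightarrow> ('f, 'v) trm set" where
  "W_incl M S' p = free_eq M S' `` p"

text \<open>The value of a class of words whose letters are elements of A. All words in the class
  have the same value; see \<open>Val_cls\<close> below.\<close>

definition Val :: "('f, 'a) algebra \<Rightarrow> ('f, 'a) trm set \<Rightarrow> 'a" where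
  "Val A p = the_elem (eval A (\<lambda>v. v) ` p)"

text \<open>The kernel of \<open>Val A\<close> on \<open>W M S\<close>, where S is a set of generators of A.\<close>

definition Ker :: "'f variety \<Rightarrow> 'a set \<Rightarrow> ('f, 'a) algebra \<Rightarrow>
    (('f, 'a) trm set \<times> ('f, 'a) trm set) set" where
  "Ker M S A = {(p, q). p \<in> carrier (W M S) \<and> q \<in> carrier (W M S) \<and> Val A p = Val A q}"


section \<open>Simple extensions and completeness\<close>

definition simple_extension ::
    "'f variety \<Rightarrow> ('f, 'a) algebra \<Rightarrow> 'a \<Rightarrow> ('f, 'a) algebra \<Rightarrow> bool" where
  "simple_extension M A a A' \<longleftrightarrow>
     A \<in> algebras M \<and> A' \<in> algebras M \<and> subalgebra (sig M) A A' \<and>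
     generates (sig M) A' (insert a (carrier A))"

definition extension_conditions ::
    "'f variety \<Rightarrow> ('f, 'a) algebra \<Rightarrow> 'a \<Rightarrow> ('f, 'a) algebra \<Rightarrow>
      (('f, 'a) trm set \<times> ('f, 'a) trm set) set" where
  "extension_conditions M A a A' =
     (let S = insert a (carrier A) in
      Ker M S A' - map_prod (W_incl M S) (W_incl M S) ` Ker M (carrier A) A)"

definition satisfies_conditions ::
    "'f variety \<Rightarrow> ('f, 'a) algebra \<Rightarrow> 'a \<Rightarrow> ('f, 'a) algebra \<Rightarrow> ('f, 'a) algebra \<Rightarrow> 'a \<Rightarrow> bool" where
  "satisfies_conditions M B x B' B1 b \<longleftrightarrow>
     (let S = insert x (carrier B) in
      \<forall>w \<in> words (sig M) S. \<forall>w' \<in> words (sig M) S.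
        (cls M S w, cls M S w') \<in> extension_conditions M B x B' \<longrightarrow>
        eval B1 ((\<lambda>v. v)(x := b)) w = eval B1 ((\<lambda>v. v)(x := b)) w')"

text \<open>Completeness with respect to the simple extensions whose elements lie in the same type as
  those of \<open>B1\<close>.\<close>

definition complete_in_type :: "'f variety \<Rightarrow> ('f, 'a) algebra \<Rightarrow> bool" where
  "complete_in_type M B1 \<longleftrightarrow>
     (\<forall>B \<in> algebras M. subalgebra (sig M) B B1 \<longrightarrow>
        (\<forall>x B'. simple_extension M B x B' \<longrightarrow>
           (\<exists>b \<in> carrier B1. satisfies_conditions M B x B' B1 b)))"

text \<open>The type of the elements of \<open>B1\<close> may be too small to contain all simple extensions of its
  subalgebras (the carrier may even be the whole type), so \<open>B1\<close> is replaced by an isomorphic copy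
  in a larger type. Every element of a simple extension of a subalgebra B by x is the value of a
  word over B and x, so the second summand has room for all elements outside B, and up to
  isomorphism over B no simple extension is lost.\<close>

definition copy :: "('f, 'b) algebra \<Rightarrow> ('f, 'b + 'd) algebra" where
  "copy A = \<lparr>carrier = Inl ` carrier A, opn = \<lambda>f xs. Inl (opn A f (map projl xs))\<rparr>"

definition complete :: "'f variety \<Rightarrow> ('f, 'b) algebra \<Rightarrow> bool" where
  "complete M B1 \<longleftrightarrow>
     complete_in_type M (copy B1 :: ('f, 'b + ('f, 'b option) trm) algebra)"


section \<open>Basic facts on free algebras\<close>

lemma eval_subst: "eval A \<rho> (subst \<sigma> t) = eval A (\<lambda>v. eval A \<rho> (\<sigma> v)) t"
  by (induction t) (auto cong: map_cong simp: comp_def)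

lemma eval_in_carrier:
  assumes "is_algebra F A" "t \<in> words F S" "\<rho> ` S \<subseteq> carrier A"
  shows "eval A \<rho> t \<in> carrier A"
  using assms(2)
proof induction
  case (Op f ts)
  have "length (map (eval A \<rho>) ts) = length ts \<and> set (map (eval A \<rho>) ts) \<subseteq> carrier A"
    using Op by auto
  with Op(1) assms(1) show ?case unfolding is_algebra_def by fastforce
qed (use assms in auto)

lemma subst_in_words:
  assumes "t \<in> words F S" "\<sigma> ` S \<subseteq> words F T"
  shows "subst \<sigma> t \<in> words F T"
  using assms by induction (auto intro!: words.intros)

lemma free_eq_words:
  assumes "is_variety M" "(s, t) \<in> free_eq M S"
  shows "s \<in> words (sig M) S \<and> t \<in> words (sig M) S"
  using assms(2)
proof induction
  case (ax l r \<sigma>)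
  then show ?case using assms(1) unfolding is_variety_def
    by (auto intro!: subst_in_words[where S = UNIV])
next
  case (cong f ss ts)
  have "\<forall>s \<in> set ss. s \<in> words (sig M) S" "\<forall>t \<in> set ts. t \<in> words (sig M) S"
    using cong(2) by (auto simp: list_all2_conv_all_nth in_set_conv_nth)
  with cong show ?case by (auto intro!: words.Op dest: list_all2_lengthD)
qed auto

lemma equiv_free_eq:
  assumes "is_variety M"
  shows "equiv (words (sig M) S) (free_eq M S)"
  using free_eq_words[OF assms]
  by (intro equivI refl_onI symI transI) (auto intro: free_eq.intros)

lemma free_eq_sound:
  assumes "A \<in> algebras M" "\<rho> ` S \<subseteq> carrier A" "(s, t) \<in> free_eq M S"
  shows "eval A \<rho> s = eval A \<rho> t"
  using assms(3)
proof induction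
  case (ax l r \<sigma>)
  have "range (\<lambda>v. eval A \<rho> (\<sigma> v)) \<subseteq> carrier A"
    using ax(2) assms eval_in_carrier[of "sig M" A _ S \<rho>] by (auto simp: algebras_def)
  then show ?case using ax(1) assms(1) unfolding eval_subst algebras_def by blast
next
  case (cong f ss ts)
  have "map (eval A \<rho>) ss = map (eval A \<rho>) ts"
    using cong(2) by (auto simp: list_all2_conv_all_nth intro: nth_equalityI)
  then show ?case by simp
qed auto

lemma Val_cls:
  assumes "A \<in> algebras M" "S \<subseteq> carrier A" "w \<in> words (sig M) S"
  shows "Val A (cls M S w) = eval A (\<lambda>v. v) w"
proof -
  have "eval A (\<lambda>v. v) ` cls M S w = {eval A (\<lambda>v. v) w}"
    using assms free_eq_sound[OF assms(1), of "\<lambda>v. v" S]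
    by (auto simp: cls_def intro: free_eq.refl intro!: image_eqI)
  then show ?thesis by (simp add: Val_def)
qed

lemma W_incl_cls:
  assumes "is_variety M" "S \<subseteq> S'" "w \<in> words (sig M) S"
  shows "W_incl M S' (cls M S w) = cls M S' w"
proof -
  have mono: "(s, t) \<in> free_eq M S'" if "(s, t) \<in> free_eq M S" for s t
  proof -
    have words: "u \<in> words (sig M) S'" if "u \<in> words (sig M) S" for u
      using that assms(2) by induction (auto intro: words.intros)
    from that show ?thesis
    proof induction
      case (cong f ss ts)
      then show ?case by (auto intro!: free_eq.cong elim: list_all2_mono)
    qed (use words in \<open>auto intro: free_eq.intros\<close>)
  qed
  show ?thesis
    using assms mono by (auto simp: W_incl_def cls_def intro: free_eq.intros)
qed

lemma opn_W_cls:
  assumes "is_variety M" "(f, length ts) \<in> sig M" "set ts \<subseteq> words (sig M) S"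
  shows "opn (W M S) f (map (cls M S) ts) = cls M S (Op f ts)"
proof -
  have rep: "(t, SOME w. w \<in> cls M S t) \<in> free_eq M S" if "t \<in> set ts" for t
  proof -
    have "t \<in> cls M S t" using that assms(3) by (auto simp: cls_def intro: free_eq.refl)
    then have "(SOME w. w \<in> cls M S t) \<in> cls M S t" by (rule someI)
    then show ?thesis by (simp add: cls_def)
  qed
  have "(Op f ts, Op f (map (\<lambda>p. SOME w. w \<in> p) (map (cls M S) ts))) \<in> free_eq M S"
    using assms(2) rep by (intro free_eq.cong) (auto simp: list_all2_conv_all_nth)
  then show ?thesis
    using equiv_class_eq[OF equiv_free_eq[OF assms(1)]] by (force simp: W_def cls_def)
qed

lemma carrier_W: "carrier (W M S) = cls M S ` words (sig M) S"
  by (auto simp: W_def cls_def quotient_def)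

lemma W_reps:
  assumes "set ps \<subseteq> carrier (W M S)"
  obtains ts where "ps = map (cls M S) ts" "set ts \<subseteq> words (sig M) S"
proof -
  have "ps \<in> lists (cls M S ` words (sig M) S)" using assms by (auto simp: carrier_W)
  then show ?thesis using that unfolding lists_image by auto
qed

lemma Op_in_words: "(f, length ts) \<in> F \<Longrightarrow> set ts \<subseteq> words F S \<Longrightarrow> Op f ts \<in> words F S"
  by (auto intro: words.Op)

lemma hom_Val:
  assumes "is_variety M" "A \<in> algebras M" "S \<subseteq> carrier A"
  shows "hom (sig M) (W M S) A (Val A)"
  unfolding hom_def
proof safe
  fix p assume "p \<in> carrier (W M S)"
  then obtain w where w: "w \<in> words (sig M) S" "p = cls M S w"
    by (auto simp: carrier_W)
  have "is_algebra (sig M) A" using assms(2) by (simp add: algebras_def)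
  then have "eval A (\<lambda>v. v) w \<in> carrier A"
    using w(1) by (rule eval_in_carrier) (use assms(3) in auto)
  then show "Val A p \<in> carrier A" using w assms by (simp add: Val_cls)
next
  fix f n ps assume *: "(f, length ps) \<in> sig M" "set ps \<subseteq> carrier (W M S)"
  obtain ts where ts: "ps = map (cls M S) ts" "set ts \<subseteq> words (sig M) S"
    using W_reps[OF *(2)] .
  have "map (Val A) ps = map (eval A (\<lambda>v. v)) ts"
    using ts assms by (auto simp: Val_cls)
  moreover have "Val A (opn (W M S) f ps) = opn A f (map (eval A (\<lambda>v. v)) ts)"
    using * ts assms by (simp add: opn_W_cls Val_cls Op_in_words)
  ultimately show "Val A (opn (W M S) f ps) = opn A f (map (Val A) ps)" by simp
qed

lemma W_in_algebras:
  assumes "is_variety M" "words (sig M) S = {} \<Longrightarrow> allow_empty M"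
  shows "W M S \<in> algebras M"
proof -
  have alg: "is_algebra (sig M) (W M S)"
    unfolding is_algebra_def
  proof safe
    fix f ps assume *: "(f, length ps) \<in> sig M" "set ps \<subseteq> carrier (W M S)"
    obtain ts where ts: "ps = map (cls M S) ts" "set ts \<subseteq> words (sig M) S"
      using W_reps[OF *(2)] .
    then show "opn (W M S) f ps \<in> carrier (W M S)"
      using * assms(1) by (auto simp: opn_W_cls carrier_W intro: Op_in_words)
  qed
  have "eval (W M S) \<rho> l = eval (W M S) \<rho> r"
    if lr: "(l, r) \<in> eqs M" and \<rho>: "range \<rho> \<subseteq> carrier (W M S)" for l r \<rho>
  proof -
    have "\<forall>v. \<exists>t. t \<in> words (sig M) S \<and> \<rho> v = cls M S t"
      using \<rho> unfolding carrier_W by blast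
    then obtain \<sigma> where \<sigma>: "\<And>v. \<sigma> v \<in> words (sig M) S" "\<And>v. \<rho> v = cls M S (\<sigma> v)"
      by metis
    have ev: "eval (W M S) \<rho> t = cls M S (subst \<sigma> t)" if "t \<in> words (sig M) UNIV" for t
      using that
    proof induction
      case (Op f ts)
      have "map (eval (W M S) \<rho>) ts = map (cls M S) (map (subst \<sigma>) ts)"
        using Op(2) by simp
      moreover have "set (map (subst \<sigma>) ts) \<subseteq> words (sig M) S"
        using Op(2) \<sigma>(1) by (force intro!: subst_in_words[where S = UNIV])
      ultimately show ?case
        using Op(1) opn_W_cls[OF assms(1), of f "map (subst \<sigma>) ts" S] by (simp del: map_map)
    qed (simp add: \<sigma>)
    have "(subst \<sigma> l, subst \<sigma> r) \<in> free_eq M S"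
      using lr \<sigma>(1) by (intro free_eq.ax) auto
    then have "cls M S (subst \<sigma> l) = cls M S (subst \<sigma> r)"
      unfolding cls_def by (rule equiv_class_eq[OF equiv_free_eq[OF assms(1)]])
    moreover have "l \<in> words (sig M) UNIV" "r \<in> words (sig M) UNIV"
      using lr assms(1) by (auto simp: is_variety_def)
    ultimately show ?thesis by (simp only: ev)
  qed
  with alg assms(2) show ?thesis by (auto simp: algebras_def carrier_W)
qed

end

(* A homomorphism from a subalgebra of B that is maximal among the extensions of f is
   total: if g : C \<rightarrow> B1 is such a homomorphism and a \<in> B, CEP extends the kernel of g to a
   congruence \<phi> on the subalgebra D generated by C and a. Then D/\<phi> is a simple extension of
   g(C) \<le> B1 by the class x of a. If x already lies in g(C), then D/\<phi> = g(C) and the quotient map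
   extends g; otherwise an element b \<in> B1 satisfying the x-extension conditions makes
   w(c, a) \<mapsto> w(g(c), b) a well-defined extension of g to D. *)

theory Submission
  imports Defs
begin

section \<open>Homomorphisms and subalgebras\<close>

lemma eval_cong_words:
  assumes "t \<in> words F S" "\<And>v. v \<in> S \<Longrightarrow> \<rho> v = \<rho>' v"
  shows "eval A \<rho> t = eval A \<rho>' t"
  using assms(1)
proof induction
  case (Op f ts)
  then have "map (eval A \<rho>) ts = map (eval A \<rho>') ts" by simp
  then show ?case by (simp only: eval.simps)
qed (use assms(2) in auto)

lemma opn_closed:
  assumes "is_algebra F A" "(f, length xs) \<in> F" "set xs \<subseteq> carrier A"
  shows "opn A f xs \<in> carrier A"
  using assms unfolding is_algebra_def by fast

lemma hom_opn:
  assumes "hom F A B h" "(f, length xs) \<in> F" "set xs \<subseteq> carrier A"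
  shows "h (opn A f xs) = opn B f (map h xs)"
  using assms unfolding hom_def by fast

lemma subalgebra_opn:
  assumes "subalgebra F A B" "(f, length xs) \<in> F" "set xs \<subseteq> carrier A"
  shows "opn A f xs = opn B f xs"
  using assms unfolding subalgebra_def by fast

lemma congruence_opn:
  assumes "congruence F A \<theta>" "(f, length xs) \<in> F"
    and "list_all2 (\<lambda>x y. (x, y) \<in> \<theta>) xs ys"
  shows "(opn A f xs, opn A f ys) \<in> \<theta>"
  using assms unfolding congruence_def by fast

lemma hom_eval:
  assumes "hom F A B h" "is_algebra F A" "t \<in> words F S" "\<rho> ` S \<subseteq> carrier A"
  shows "h (eval A \<rho> t) = eval B (\<lambda>v. h (\<rho> v)) t"
  using assms(3)
proof induction
  case (Op f ts)
  have "set (map (eval A \<rho>) ts) \<subseteq> carrier A"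
    using Op eval_in_carrier[OF assms(2) _ assms(4)] by auto
  then have "h (opn A f (map (eval A \<rho>) ts)) = opn B f (map h (map (eval A \<rho>) ts))"
    using Op(1) hom_opn[OF assms(1)] by simp
  moreover have "map h (map (eval A \<rho>) ts) = map (eval B (\<lambda>v. h (\<rho> v))) ts"
    using Op by simp
  ultimately show ?case by (simp only: eval.simps)
qed simp

lemma subalgebra_hom: "subalgebra F A B \<Longrightarrow> hom F A B (\<lambda>x. x)"
  unfolding subalgebra_def hom_def by auto

lemma subalgebra_eval:
  assumes "subalgebra F A B" "t \<in> words F S" "\<rho> ` S \<subseteq> carrier A"
  shows "eval A \<rho> t = eval B \<rho> t"
  using hom_eval[OF subalgebra_hom[OF assms(1)] _ assms(2,3)] assms(1)
  by (simp add: subalgebra_def)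

lemma subalgebra_restrict:
  assumes "is_algebra F B" "X \<subseteq> carrier B"
    and "\<And>f xs. (f, length xs) \<in> F \<Longrightarrow> set xs \<subseteq> X \<Longrightarrow> opn B f xs \<in> X"
  shows "subalgebra F (B\<lparr>carrier := X\<rparr>) B"
  using assms unfolding subalgebra_def is_algebra_def by auto

text \<open>Equations pass down because a word has the same value in \<open>A\<close> as in
  \<open>B\<close>. Nonemptiness does not pass down, so the case of an empty \<open>A\<close> is a
  premise of its own.\<close>

lemma subalgebra_in_algebras:
  assumes "is_variety M" "subalgebra (sig M) A B" "B \<in> algebras M"
    and "carrier A = {} \<Longrightarrow> allow_empty M"
  shows "A \<in> algebras M"
proof -
  have "eval A \<rho> l = eval A \<rho> r" if "(l, r) \<in> eqs M" "range \<rho> \<subseteq> carrier A" for l r \<rho>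
  proof -
    have "l \<in> words (sig M) UNIV" "r \<in> words (sig M) UNIV"
      using that assms(1) by (auto simp: is_variety_def)
    then have "eval A \<rho> l = eval B \<rho> l" "eval A \<rho> r = eval B \<rho> r"
      using subalgebra_eval[OF assms(2)] that(2) by blast+
    moreover have "range \<rho> \<subseteq> carrier B" using that assms(2) by (auto simp: subalgebra_def)
    then have "eval B \<rho> l = eval B \<rho> r" using that assms(3) unfolding algebras_def by blast
    ultimately show ?thesis by simp
  qed
  then show ?thesis using assms by (auto simp: algebras_def subalgebra_def)
qed

section \<open>Homomorphic images and the isomorphic copy\<close>

lemma list_preimage:
  assumes "set ys \<subseteq> h ` X"
  obtains xs where "ys = map h xs" "set xs \<subseteq> X"
proof -
  have "ys \<in> lists (h ` X)" using assms by auto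
  then show ?thesis using that unfolding lists_image by auto
qed

text \<open>A valuation in \<open>B\<close> lifts through chosen preimages to one in
  \<open>A\<close>, where the equations hold, and \<open>h\<close> carries the equal values back.
  \<open>B\<close> may be a bare record: its closure under the operations also comes from
  surjectivity. This puts both quotients and copies into the variety.\<close>

lemma hom_image_in_algebras:
  assumes "is_variety M" "A \<in> algebras M" "hom (sig M) A B h" "carrier B = h ` carrier A"
  shows "B \<in> algebras M"
proof -
  have A: "is_algebra (sig M) A" using assms(2) by (simp add: algebras_def)
  have "is_algebra (sig M) B"
    unfolding is_algebra_def
  proof safe
    fix f ys assume *: "(f, length ys) \<in> sig M" "set ys \<subseteq> carrier B"
    obtain xs where xs: "ys = map h xs" "set xs \<subseteq> carrier A"
      using list_preimage * assms(4) by metis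
    have "opn A f xs \<in> carrier A" using opn_closed[OF A] xs * by simp
    moreover have "h (opn A f xs) = opn B f ys" using hom_opn[OF assms(3)] xs * by simp
    ultimately show "opn B f ys \<in> carrier B" using assms(4) by (metis imageI)
  qed
  moreover have "eval B \<rho> l = eval B \<rho> r"
    if lr: "(l, r) \<in> eqs M" and \<rho>: "range \<rho> \<subseteq> carrier B" for l r \<rho>
  proof -
    define \<rho>' where "\<rho>' v = inv_into (carrier A) h (\<rho> v)" for v
    have \<rho>': "h (\<rho>' v) = \<rho> v" "\<rho>' v \<in> carrier A" for v
      using \<rho> assms(4) unfolding \<rho>'_def
      by (metis f_inv_into_f range_subsetD, metis inv_into_into range_subsetD)
    have "eval B \<rho> t = h (eval A \<rho>' t)" if "t \<in> words (sig M) UNIV" for t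
      using hom_eval[OF assms(3) A that, of \<rho>'] \<rho>' by (simp add: image_subset_iff)
    moreover have "l \<in> words (sig M) UNIV" "r \<in> words (sig M) UNIV"
      using lr assms(1) by (auto simp: is_variety_def)
    moreover have "range \<rho>' \<subseteq> carrier A" using \<rho>' by auto
    then have "eval A \<rho>' l = eval A \<rho>' r" using assms(2) lr unfolding algebras_def by blast
    ultimately show ?thesis by simp
  qed
  ultimately show ?thesis using assms(2,4) by (auto simp: algebras_def)
qed

lemma generates_hom_image:
  assumes "generates F A X" "is_algebra F A" "hom F A B h" "carrier B = h ` carrier A"
  shows "generates F B (h ` X)"
  unfolding generates_def
proof (intro conjI allI impI)
  show "h ` X \<subseteq> carrier B" using assms(1,4) by (auto simp: generates_def)
  fix E assume E: "subalgebra F E B \<and> h ` X \<subseteq> carrier E"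
  let ?P = "{d \<in> carrier A. h d \<in> carrier E}"
  have "subalgebra F (A\<lparr>carrier := ?P\<rparr>) A"
  proof (rule subalgebra_restrict[OF assms(2)])
    fix f xs assume *: "(f, length xs) \<in> F" "set xs \<subseteq> ?P"
    have "h (opn A f xs) = opn B f (map h xs)"
      using hom_opn[OF assms(3)] * by blast
    also have "\<dots> = opn E f (map h xs)"
      using subalgebra_opn[of F E B f "map h xs"] E * by fastforce
    also have "\<dots> \<in> carrier E"
      using opn_closed[of F E f "map h xs"] E * by (fastforce simp: subalgebra_def)
    finally show "opn A f xs \<in> ?P"
      using opn_closed[OF assms(2)] * by blast
  qed auto
  moreover have "X \<subseteq> ?P" using E assms(1) by (auto simp: generates_def)
  ultimately have "carrier (A\<lparr>carrier := ?P\<rparr>) = carrier A"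
    using assms(1) unfolding generates_def by fastforce
  then show "carrier E = carrier B"
    using E assms(4) by (auto simp: subalgebra_def)
qed

text \<open>Completeness speaks about the copy and injectivity about the algebra itself; these two
  maps lead from one to the other.\<close>

lemma hom_copy:
  fixes A :: "('f, 'b) algebra"
  shows "hom F A (copy A :: ('f, 'b + 'd) algebra) Inl"
    and "hom F (copy A :: ('f, 'b + 'd) algebra) A projl"
  by (auto simp: hom_def copy_def comp_def)

lemma copy_in_algebras:
  assumes "is_variety M" "A \<in> algebras M"
  shows "copy A \<in> algebras M"
  by (rule hom_image_in_algebras[OF assms hom_copy(1)]) (simp add: copy_def)

lemma hom_comp:
  assumes "hom F A B g" "hom F B C h"
  shows "hom F A C (\<lambda>x. h (g x))"
  unfolding hom_def
proof safe
  show "\<And>x. x \<in> carrier A \<Longrightarrow> h (g x) \<in> carrier C"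
    using assms by (auto simp: hom_def image_subset_iff)
  fix f xs assume *: "(f, length xs) \<in> F" "set xs \<subseteq> carrier A"
  then have "set (map g xs) \<subseteq> carrier B" using assms(1) by (auto simp: hom_def)
  then show "h (g (opn A f xs)) = opn C f (map (\<lambda>x. h (g x)) xs)"
    using hom_opn[OF assms(1) *] hom_opn[OF assms(2), of f "map g xs"] *(1)
    by (simp add: comp_def)
qed

lemma hom_subalgebra_codomain:
  assumes "hom F A B h" "subalgebra F B C"
  shows "hom F A C h"
  using hom_comp[OF assms(1) subalgebra_hom[OF assms(2)]] by simp


section \<open>Subalgebras generated by a set, and quotients\<close>

text \<open>Taking values of words, instead of an intersection of subalgebras, provides each element
  with a word that represents it. Maps out of the generated subalgebra are defined by means of such
  words.\<close>

definition span :: "'f signature \<Rightarrow> ('f, 'a) algebra \<Rightarrow> 'a set \<Rightarrow> ('f, 'a) algebra" where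
  "span F B S = B\<lparr>carrier := eval B (\<lambda>v. v) ` words F S\<rparr>"

lemma subalgebra_span:
  assumes "is_algebra F B" "S \<subseteq> carrier B"
  shows "subalgebra F (span F B S) B"
  unfolding span_def
proof (rule subalgebra_restrict[OF assms(1)])
  show "eval B (\<lambda>v. v) ` words F S \<subseteq> carrier B"
    using eval_in_carrier[OF assms(1), of _ S] assms(2) by auto
  fix f xs assume *: "(f, length xs) \<in> F" "set xs \<subseteq> eval B (\<lambda>v. v) ` words F S"
  obtain ts where "xs = map (eval B (\<lambda>v. v)) ts" "set ts \<subseteq> words F S"
    using list_preimage[OF *(2)] .
  then show "opn B f xs \<in> eval B (\<lambda>v. v) ` words F S"
    using * Op_in_words[of f ts F S] by (force intro!: image_eqI[of _ _ "Op f ts"])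
qed

lemma span_superset: "S \<subseteq> carrier (span F B S)"
  by (force simp: span_def intro: words.Var image_eqI[of _ _ "Var _"])

lemma carrier_span_eval:
  assumes "is_algebra F B" "S \<subseteq> carrier B"
  shows "carrier (span F B S) = eval (span F B S) (\<lambda>v. v) ` words F S"
proof -
  have "eval (span F B S) (\<lambda>v. v) t = eval B (\<lambda>v. v) t" if "t \<in> words F S" for t
    using subalgebra_eval[OF subalgebra_span[OF assms] that] span_superset[of S F B] by simp
  then show ?thesis by (simp add: span_def)
qed

lemma generates_eval:
  assumes "carrier D = eval D (\<lambda>v. v) ` words F S"
  shows "generates F D S"
  unfolding generates_def
proof (intro conjI allI impI)
  show "S \<subseteq> carrier D"
    unfolding assms by (force intro: words.Var image_eqI[of _ _ "Var _"])
  fix E assume E: "subalgebra F E D \<and> S \<subseteq> carrier E"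
  have "eval D (\<lambda>v. v) t \<in> carrier E" if "t \<in> words F S" for t
    using subalgebra_eval[of F E D t S "\<lambda>v. v"] eval_in_carrier[of F E t S "\<lambda>v. v"] E that
    by (simp add: subalgebra_def)
  with assms E show "carrier E = carrier D" by (auto simp: subalgebra_def)
qed

text \<open>The map evaluates in \<open>Q\<close> a chosen word for \<open>d\<close>. By
  \<open>wd\<close> the choice does not matter, so the value of \<open>Op f ws\<close> may be
  computed from words chosen for the arguments.\<close>

lemma hom_from_words:
  assumes D: "carrier D = eval D (\<lambda>v. v) ` words F S"
    and Q: "is_algebra F Q" "\<rho> ` S \<subseteq> carrier Q"
    and wd: "\<And>w w'. w \<in> words F S \<Longrightarrow> w' \<in> words F S \<Longrightarrow>
      eval D (\<lambda>v. v) w = eval D (\<lambda>v. v) w' \<Longrightarrow> eval Q \<rho> w = eval Q \<rho> w'"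
  obtains k where "hom F D Q k" "\<And>s. s \<in> S \<Longrightarrow> k s = \<rho> s"
proof -
  define k where "k d = eval Q \<rho> (inv_into (words F S) (eval D (\<lambda>v. v)) d)" for d
  have k: "k (eval D (\<lambda>v. v) w) = eval Q \<rho> w" if "w \<in> words F S" for w
    unfolding k_def using that by (intro wd) (auto simp: inv_into_into f_inv_into_f)
  have "hom F D Q k"
    unfolding hom_def
  proof safe
    fix d assume "d \<in> carrier D"
    then show "k d \<in> carrier Q"
      using D k eval_in_carrier[OF Q(1) _ Q(2)] by auto
  next
    fix f ds assume *: "(f, length ds) \<in> F" "set ds \<subseteq> carrier D"
    obtain ws where ws: "ds = map (eval D (\<lambda>v. v)) ws" "set ws \<subseteq> words F S"
      using list_preimage * D by metis
    have "k (eval D (\<lambda>v. v) (Op f ws)) = eval Q \<rho> (Op f ws)"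
      using * ws by (intro k Op_in_words) auto
    moreover have "map k ds = map (eval Q \<rho>) ws" using ws k by auto
    ultimately show "k (opn D f ds) = opn Q f (map k ds)" by (simp only: ws(1) eval.simps)
  qed
  moreover have "k s = \<rho> s" if "s \<in> S" for s
    using k[of "Var s"] that by (simp add: words.Var)
  ultimately show thesis using that by blast
qed

section \<open>Congruences, kernels and quotients\<close>

lemma congruence_eval:
  assumes "congruence F A \<phi>" "t \<in> words F S" "\<And>v. v \<in> S \<Longrightarrow> (\<rho> v, \<rho>' v) \<in> \<phi>"
  shows "(eval A \<rho> t, eval A \<rho>' t) \<in> \<phi>"
  using assms(2)
proof induction
  case (Op f ts)
  then have "list_all2 (\<lambda>x y. (x, y) \<in> \<phi>) (map (eval A \<rho>) ts) (map (eval A \<rho>') ts)"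
    by (auto simp: list_all2_conv_all_nth)
  then show ?case using Op(1) congruence_opn[OF assms(1)] by simp
qed (use assms(3) in auto)

lemma congruence_kernel:
  assumes "hom F A B g" "is_algebra F A"
  shows "congruence F A {(x, y). x \<in> carrier A \<and> y \<in> carrier A \<and> g x = g y}"
    (is "congruence F A ?\<theta>")
  unfolding congruence_def
proof safe
  show "equiv (carrier A) ?\<theta>"
    by (rule equivI) (auto simp: refl_on_def sym_def trans_def)
next
  fix f xs ys assume *: "(f, length xs) \<in> F" "list_all2 (\<lambda>x y. (x, y) \<in> ?\<theta>) xs ys"
  have sets: "set xs \<subseteq> carrier A" "set ys \<subseteq> carrier A" and len: "length ys = length xs"
    and m: "map g xs = map g ys"
    using *(2) by (auto simp: list_all2_conv_all_nth in_set_conv_nth intro!: nth_equalityI)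
  show "opn A f xs \<in> carrier A" "opn A f ys \<in> carrier A"
    using opn_closed[OF assms(2)] * sets len by simp_all
  have "g (opn A f xs) = opn B f (map g xs)" "g (opn A f ys) = opn B f (map g ys)"
    using hom_opn[OF assms(1)] * sets len by simp_all
  then show "g (opn A f xs) = g (opn A f ys)" using m by simp
qed

text \<open>Any map \<open>h\<close> whose fibres are the classes of the congruence serves as
  quotient map. This leaves the element type of the quotient free, as is needed because completeness
  only concerns simple extensions in one fixed type.\<close>

lemma quotient_on_image:
  assumes "congruence F D \<phi>"
    and ker: "\<And>d d'. d \<in> carrier D \<Longrightarrow> d' \<in> carrier D \<Longrightarrow> h d = h d' \<longleftrightarrow> (d, d') \<in> \<phi>"
  obtains E where "carrier E = h ` carrier D" "hom F D E h"
proof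
  let ?i = "inv_into (carrier D) h"
  let ?E = "\<lparr>carrier = h ` carrier D, opn = \<lambda>f xs. h (opn D f (map ?i xs))\<rparr>"
  show "carrier ?E = h ` carrier D" by simp
  have dom: "x \<in> carrier D \<and> y \<in> carrier D" if "(x, y) \<in> \<phi>" for x y
    using assms(1) that equiv_type[of "carrier D" \<phi>] by (auto simp: congruence_def)
  show "hom F D ?E h"
    unfolding hom_def
  proof safe
    fix f ds assume *: "(f, length ds) \<in> F" "set ds \<subseteq> carrier D"
    \<comment> \<open>\<open>d\<close> and the chosen preimage of \<open>h d\<close> lie in one
      fibre, so operating on representatives gives a congruent result.\<close>
    have "(d, ?i (h d)) \<in> \<phi>" if "d \<in> carrier D" for d
      using that ker[of d "?i (h d)"] by (simp add: inv_into_into f_inv_into_f)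
    then have "list_all2 (\<lambda>x y. (x, y) \<in> \<phi>) ds (map (\<lambda>d. ?i (h d)) ds)"
      using *(2) by (simp add: list_all2_conv_all_nth subset_iff)
    then have "(opn D f ds, opn D f (map (\<lambda>d. ?i (h d)) ds)) \<in> \<phi>"
      using congruence_opn[OF assms(1)] *(1) by blast
    then show "h (opn D f ds) = opn ?E f (map h ds)"
      using ker dom by (simp add: comp_def)
  qed auto
qed

text \<open>The class of an element of \<open>C\<close> is coded by its value under \<open>g\<close>, and any other class by a
  word over \<open>g(C)\<close> and one further letter, \<open>None\<close>, which stands for \<open>a\<close>.\<close>

lemma quotient_coding:
  fixes g :: "'c \<Rightarrow> 'b" and D :: "('f, 'c) algebra"
  assumes cg: "congruence F D \<phi>" and C: "C \<subseteq> carrier D"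
    and D: "carrier D = eval D (\<lambda>v. v) ` words F (insert a C)"
    and ker: "\<And>c c'. c \<in> C \<Longrightarrow> c' \<in> C \<Longrightarrow> (c, c') \<in> \<phi> \<longleftrightarrow> g c = g c'"
  shows "\<exists>h :: 'c \<Rightarrow> 'b + ('f, 'b option) trm.
    (\<forall>d \<in> carrier D. \<forall>d' \<in> carrier D. h d = h d' \<longleftrightarrow> (d, d') \<in> \<phi>) \<and> (\<forall>c \<in> C. h c = Inl (g c))"
proof -
  have eq: "equiv (carrier D) \<phi>" using cg by (simp add: congruence_def)
  have refl: "(d, d) \<in> \<phi>" if "d \<in> carrier D" for d
    using eq that by (meson equivE refl_onD)
  have sym: "(d', d) \<in> \<phi>" if "(d, d') \<in> \<phi>" for d d'
    using eq that by (meson equivE symD)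
  have trans: "(d, d'') \<in> \<phi>" if "(d, d') \<in> \<phi>" "(d', d'') \<in> \<phi>" for d d' d''
    using eq that by (meson equivE transD)
  \<comment> \<open>This decodes letters: \<open>None\<close> stands for \<open>a\<close>, and
    \<open>Some y\<close> for a chosen element of \<open>C\<close> with value \<open>y\<close> under
    \<open>g\<close>.\<close>
  define \<sigma> where "\<sigma> = case_option a (inv_into C g)"
  define P where "P d c \<longleftrightarrow> c \<in> C \<and> (d, c) \<in> \<phi>" for d c
  define T where "T d t \<longleftrightarrow> (d, eval D \<sigma> t) \<in> \<phi>" for d t
  \<comment> \<open>\<open>P d\<close> and \<open>T d\<close> depend only on the class of
    \<open>d\<close>, so \<open>SOME\<close> selects the same code for congruent elements. The first
    case applies exactly when the class meets \<open>C\<close>.\<close>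
  define h where "h d = (if \<exists>c. P d c then Inl (g (SOME c. P d c)) else Inr (SOME t. T d t))"
    for d
  have T: "\<exists>t. T d t" if d: "d \<in> carrier D" for d
  proof -
    obtain w where w: "w \<in> words F (insert a C)" "d = eval D (\<lambda>v. v) w"
      using d D by blast
    \<comment> \<open>Coding a letter \<open>v\<close> of \<open>C\<close> and decoding it again may
      give another element of \<open>C\<close>, but one with the same value under \<open>g\<close>,
      hence congruent to \<open>v\<close> by \<open>ker\<close>. So the recoded word still
      represents the class of \<open>d\<close>.\<close>
    define \<tau> :: "'c \<Rightarrow> ('f, 'b option) trm"
      where "\<tau> v = Var (if v = a then None else Some (g v))" for v
    have "(v, eval D \<sigma> (\<tau> v)) \<in> \<phi>" if "v \<in> insert a C" for v
    proof (cases "v = a")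
      case True
      have "a \<in> carrier D"
        unfolding D by (rule image_eqI[of _ _ "Var a"]) (auto intro: words.Var)
      then show ?thesis using True refl by (simp add: \<tau>_def \<sigma>_def)
    next
      case False
      then have v: "v \<in> C" using that by simp
      then have "inv_into C g (g v) \<in> C" "g (inv_into C g (g v)) = g v"
        by (auto simp: inv_into_into f_inv_into_f)
      then show ?thesis using False v ker by (simp add: \<tau>_def \<sigma>_def)
    qed
    then have "(eval D (\<lambda>v. v) w, eval D (\<lambda>v. eval D \<sigma> (\<tau> v)) w) \<in> \<phi>"
      by (rule congruence_eval[OF cg w(1)])
    then show ?thesis unfolding T_def w(2) eval_subst[symmetric] by blast
  qed
  have "h d = h d' \<longleftrightarrow> (d, d') \<in> \<phi>" if d: "d \<in> carrier D" "d' \<in> carrier D" for d d'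
  proof
    assume "(d, d') \<in> \<phi>"
    then have "P d = P d'" "T d = T d'"
      unfolding fun_eq_iff P_def T_def using sym trans by blast+
    then show "h d = h d'" by (simp add: h_def)
  next
    assume hh: "h d = h d'"
    show "(d, d') \<in> \<phi>"
    proof (cases "\<exists>c. P d c")
      case True
      then have ex: "\<exists>c. P d' c" using hh by (auto simp: h_def split: if_splits)
      let ?c = "SOME c. P d c" and ?c' = "SOME c. P d' c"
      have "P d ?c" "P d' ?c'" by (rule someI_ex[OF True], rule someI_ex[OF ex])
      moreover have "g ?c = g ?c'" using hh True ex by (simp add: h_def)
      ultimately have "(d, ?c) \<in> \<phi>" "(?c, ?c') \<in> \<phi>" "(d', ?c') \<in> \<phi>"
        using ker unfolding P_def by simp_all
      then show ?thesis using sym trans by blast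
    next
      case False
      then have nex: "\<not> (\<exists>c. P d' c)" using hh by (auto simp: h_def split: if_splits)
      then have "(SOME t. T d t) = (SOME t. T d' t)" using hh False by (simp add: h_def)
      moreover have "T d (SOME t. T d t)" "T d' (SOME t. T d' t)"
        by (rule someI_ex[OF T[OF d(1)]], rule someI_ex[OF T[OF d(2)]])
      ultimately show ?thesis unfolding T_def using sym trans by metis
    qed
  qed
  moreover have "h c = Inl (g c)" if c: "c \<in> C" for c
  proof -
    have ex: "\<exists>c'. P c c'" using c C refl by (auto simp: P_def)
    then have "P c (SOME c'. P c c')" by (rule someI_ex)
    then have "g (SOME c'. P c c') = g c" using c ker unfolding P_def by metis
    then show ?thesis using ex by (simp add: h_def)
  qed
  ultimately show ?thesis by (intro exI[of _ h]) blast
qed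


section \<open>Extension of homomorphisms\<close>

text \<open>For the letter \<open>x \<notin> B\<close>, the pairs of words that the extension conditions leave out impose
  nothing: both words are equal in the free algebra to words over \<open>B\<close>.\<close>

lemma satisfies_conditions_eval:
  assumes M: "is_variety M" and Q: "Q \<in> algebras M" and sub: "subalgebra (sig M) B Q"
    and se: "simple_extension M B x B'" and x: "x \<notin> carrier B"
    and b: "b \<in> carrier Q" "satisfies_conditions M B x B' Q b"
    and u: "u \<in> words (sig M) (insert x (carrier B))"
      "u' \<in> words (sig M) (insert x (carrier B))"
    and eq: "eval B' (\<lambda>v. v) u = eval B' (\<lambda>v. v) u'"
  shows "eval Q ((\<lambda>v. v)(x := b)) u = eval Q ((\<lambda>v. v)(x := b)) u'"
proof -
  let ?S = "insert x (carrier B)" and ?\<rho> = "(\<lambda>v. v)(x := b)"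
  have B: "B \<in> algebras M" and B': "B' \<in> algebras M" and S: "?S \<subseteq> carrier B'"
    using se by (auto simp: simple_extension_def generates_def)
  have \<rho>: "?\<rho> ` ?S \<subseteq> carrier Q" using b(1) sub by (auto simp: subalgebra_def)
  have K: "(cls M ?S u, cls M ?S u') \<in> Ker M ?S B'"
    using u eq by (auto simp: Ker_def carrier_W Val_cls[OF B' S])
  show ?thesis
  proof (cases "(cls M ?S u, cls M ?S u') \<in>
      map_prod (W_incl M ?S) (W_incl M ?S) ` Ker M (carrier B) B")
    case False
    with K have "(cls M ?S u, cls M ?S u') \<in> extension_conditions M B x B'"
      by (simp add: extension_conditions_def Let_def)
    then show ?thesis using b(2) u by (auto simp: satisfies_conditions_def Let_def)
  next
    case True
    then obtain p q where pq: "p \<in> words (sig M) (carrier B)" "q \<in> words (sig M) (carrier B)"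
      "cls M ?S u = W_incl M ?S (cls M (carrier B) p)"
      "cls M ?S u' = W_incl M ?S (cls M (carrier B) q)"
      "Val B (cls M (carrier B) p) = Val B (cls M (carrier B) q)"
      by (auto simp: Ker_def carrier_W)
    \<comment> \<open>The value of \<open>t\<close> does not depend on \<open>b\<close>:
      \<open>t\<close> equals \<open>p\<close> in the free algebra, and the letter \<open>x\<close>,
      being outside \<open>B\<close>, does not occur in \<open>p\<close>.\<close>
    have *: "eval Q ?\<rho> t = eval B (\<lambda>v. v) p"
      if t: "t \<in> words (sig M) ?S" and p: "p \<in> words (sig M) (carrier B)"
        and c: "cls M ?S t = W_incl M ?S (cls M (carrier B) p)" for t p
    proof -
      have "cls M ?S t = cls M ?S p"
        using W_incl_cls[OF M _ p, of ?S] c by auto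
      moreover have "t \<in> cls M ?S t" using t by (simp add: cls_def free_eq.refl)
      ultimately have "(p, t) \<in> free_eq M ?S" by (simp add: cls_def)
      then have "eval Q ?\<rho> t = eval Q ?\<rho> p" using free_eq_sound[OF Q \<rho>] by simp
      also have "\<dots> = eval Q (\<lambda>v. v) p" by (rule eval_cong_words[OF p]) (use x in auto)
      also have "\<dots> = eval B (\<lambda>v. v) p" using subalgebra_eval[OF sub p] by simp
      finally show ?thesis .
    qed
    have "eval B (\<lambda>v. v) p = eval B (\<lambda>v. v) q"
      using pq by (simp add: Val_cls[OF B])
    then show ?thesis using *[OF u(1) pq(1,3)] *[OF u(2) pq(2,4)] by simp
  qed
qed

section \<open>Extending a homomorphism by one element\<close>

lemma hom_image_subalgebra:
  assumes "is_algebra F A" "is_algebra F B" "hom F A B h"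
  shows "subalgebra F (B\<lparr>carrier := h ` carrier A\<rparr>) B"
proof (rule subalgebra_restrict[OF assms(2)])
  show "h ` carrier A \<subseteq> carrier B" using assms(3) by (simp add: hom_def)
  fix f ys assume *: "(f, length ys) \<in> F" "set ys \<subseteq> h ` carrier A"
  obtain xs where xs: "ys = map h xs" "set xs \<subseteq> carrier A"
    using list_preimage[OF *(2)] .
  have "opn A f xs \<in> carrier A" using opn_closed[OF assms(1)] xs * by simp
  moreover have "opn B f ys = h (opn A f xs)" using hom_opn[OF assms(3)] xs * by simp
  ultimately show "opn B f ys \<in> h ` carrier A" by simp
qed

text \<open>This is the step that refutes maximality of a homomorphism that is not total, and the
  one place where CEP and completeness do their work. CEP is applied only to subalgebras of
  \<open>B\<close>, so having it for the element type of \<open>B\<close> suffices.\<close>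

lemma hom_extension_step:
  fixes M :: "'f variety" and Q :: "('f, 'b) algebra" and B :: "('f, 'c) algebra"
  assumes M: "is_variety M" and CEP: "CEP (sig M) (algebras M :: ('f, 'c) algebra set)"
    and Q: "Q \<in> algebras M" and comp: "complete M Q"
    and B: "B \<in> algebras M" and C: "C \<in> algebras M" "subalgebra (sig M) C B"
    and g: "hom (sig M) C Q g" and a: "a \<in> carrier B"
  obtains D k where "subalgebra (sig M) D B" "insert a (carrier C) \<subseteq> carrier D"
    "hom (sig M) D Q k" "\<And>c. c \<in> carrier C \<Longrightarrow> k c = g c"
proof -
  let ?F = "sig M" and ?S = "insert a (carrier C)"
  define D where "D = span ?F B ?S"
  have Ba: "is_algebra ?F B" and Qa: "is_algebra ?F Q" and Ca: "is_algebra ?F C"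
    using B Q C by (auto simp: algebras_def)
  have S: "?S \<subseteq> carrier B" using a C by (auto simp: subalgebra_def)
  have DB: "subalgebra ?F D B" unfolding D_def by (rule subalgebra_span[OF Ba S])
  have SD: "?S \<subseteq> carrier D" unfolding D_def by (rule span_superset)
  have Dev: "carrier D = eval D (\<lambda>v. v) ` words ?F ?S"
    unfolding D_def by (rule carrier_span_eval[OF Ba S])
  have Da: "is_algebra ?F D" using DB by (simp add: subalgebra_def)
  have Dalg: "D \<in> algebras M"
    by (rule subalgebra_in_algebras[OF M DB B]) (use SD in auto)
  have CD: "subalgebra ?F C D"
    using C(2) SD Da by (auto simp: subalgebra_def D_def span_def)
  define \<theta> where "\<theta> = {(x, y). x \<in> carrier C \<and> y \<in> carrier C \<and> g x = g y}"
  have "congruence ?F C \<theta>" unfolding \<theta>_def by (rule congruence_kernel[OF g Ca])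
  \<comment> \<open>On \<open>C\<close> the congruence identifies exactly what \<open>g\<close>
    identifies, so the image of \<open>C\<close> in the quotient of \<open>D\<close> is a copy of
    the image of \<open>g\<close>.\<close>
  then obtain \<phi> where cg: "congruence ?F D \<phi>" and \<phi>: "\<theta> = \<phi> \<inter> (carrier C \<times> carrier C)"
    using CEP Dalg C(1) CD unfolding CEP_def by blast
  have ker: "(c, c') \<in> \<phi> \<longleftrightarrow> g c = g c'" if "c \<in> carrier C" "c' \<in> carrier C" for c c'
    using \<phi> that by (auto simp: \<theta>_def)
  have "carrier C \<subseteq> carrier D" using SD by simp
  from quotient_coding[OF cg this Dev ker] obtain h :: "'c \<Rightarrow> 'b + ('f, 'b option) trm"
    where h: "\<And>d d'. d \<in> carrier D \<Longrightarrow> d' \<in> carrier D \<Longrightarrow> h d = h d' \<longleftrightarrow> (d, d') \<in> \<phi>"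
      and hC: "\<And>c. c \<in> carrier C \<Longrightarrow> h c = Inl (g c)"
    by blast
  obtain E where E: "carrier E = h ` carrier D" and hE: "hom ?F D E h"
    using quotient_on_image[OF cg h] by metis
  have Ealg: "E \<in> algebras M" by (rule hom_image_in_algebras[OF M Dalg hE E])
  then have Ea: "is_algebra ?F E" by (simp add: algebras_def)
  let ?Q = "copy Q :: ('f, 'b + ('f, 'b option) trm) algebra"
  have Q': "?Q \<in> algebras M" by (rule copy_in_algebras[OF M Q])
  then have Qa': "is_algebra ?F ?Q" by (simp add: algebras_def)
  have gQ': "hom ?F C ?Q (\<lambda>c. Inl (g c))" by (rule hom_comp[OF g hom_copy(1)])
  have hCQ: "hom ?F C ?Q h"
  proof -
    have "map h xs = map (\<lambda>c. Inl (g c)) xs" if "set xs \<subseteq> carrier C" for xs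
      using that hC by auto
    moreover have "opn C f xs \<in> carrier C" if "(f, length xs) \<in> ?F" "set xs \<subseteq> carrier C" for f xs
      using opn_closed[OF Ca] that by simp
    ultimately show ?thesis using gQ' hC by (auto simp: hom_def image_subset_iff simp del: map_eq_conv)
  qed
  define G where "G = ?Q\<lparr>carrier := h ` carrier C\<rparr>"
  have Gc: "carrier G = h ` carrier C" by (simp add: G_def)
  have GQ: "subalgebra ?F G ?Q"
    unfolding G_def by (rule hom_image_subalgebra[OF Ca Qa' hCQ])
  have Galg: "G \<in> algebras M"
    by (rule subalgebra_in_algebras[OF M GQ Q']) (use C(1) Gc in \<open>auto simp: algebras_def\<close>)
  have GE: "subalgebra ?F G E"
    unfolding subalgebra_def
  proof safe
    show "is_algebra ?F G" using Galg by (simp add: algebras_def)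
    show "\<And>y. y \<in> carrier G \<Longrightarrow> y \<in> carrier E" using Gc E SD by auto
    fix f ys assume *: "(f, length ys) \<in> ?F" "set ys \<subseteq> carrier G"
    obtain xs where xs: "ys = map h xs" "set xs \<subseteq> carrier C"
      using list_preimage * Gc by metis
    have "opn E f ys = h (opn D f xs)"
      using hom_opn[OF hE, of f xs] xs * SD by (simp add: subset_iff)
    also have "opn D f xs = opn C f xs"
      using subalgebra_opn[OF CD] xs * by simp
    also have "h (opn C f xs) = opn ?Q f ys"
      using hom_opn[OF hCQ] xs * by simp
    finally show "opn G f ys = opn E f ys" by (simp add: G_def)
  qed (rule Ea)
  have gen: "generates ?F E (insert (h a) (carrier G))"
    using generates_hom_image[OF generates_eval[OF Dev] Da hE E] Gc by simp
  have se: "simple_extension M G (h a) E"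
    unfolding simple_extension_def using Galg Ealg GE gen by simp
  have "\<exists>k. hom ?F D Q k \<and> (\<forall>c \<in> carrier C. k c = g c)"
  proof (cases "h a \<in> carrier G")
    \<comment> \<open>Here \<open>E\<close> adds nothing to \<open>G\<close>, so there are no
      extension conditions and completeness would give an arbitrary \<open>b\<close>. Instead
      \<open>h\<close> itself already takes all its values in the copy of \<open>Q\<close>.\<close>
    case True
    then have GE': "carrier G = carrier E"
      using gen GE unfolding generates_def by blast
    have "hom ?F D G h"
      unfolding hom_def
    proof safe
      show "\<And>d. d \<in> carrier D \<Longrightarrow> h d \<in> carrier G" using GE' E by simp
      fix f xs assume *: "(f, length xs) \<in> ?F" "set xs \<subseteq> carrier D"
      then have "set (map h xs) \<subseteq> carrier G" using GE' E by auto
      then show "h (opn D f xs) = opn G f (map h xs)"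
        using hom_opn[OF hE *] subalgebra_opn[OF GE, of f "map h xs"] *(1) by simp
    qed
    then have "hom ?F D ?Q h" by (rule hom_subalgebra_codomain[OF _ GQ])
    then have "hom ?F D Q (\<lambda>d. projl (h d))" by (rule hom_comp[OF _ hom_copy(2)])
    then show ?thesis using hC by (intro exI[of _ "\<lambda>d. projl (h d)"]) auto
  next
    case False
    obtain b where b: "b \<in> carrier ?Q" "satisfies_conditions M G (h a) E ?Q b"
      using comp Galg GQ se unfolding complete_def complete_in_type_def by blast
    let ?r = "(\<lambda>v. v)(h a := b)"
    let ?\<rho> = "\<lambda>v. ?r (h v)"
    have \<rho>: "?\<rho> ` ?S \<subseteq> carrier ?Q"
      using b(1) GQ Gc by (auto simp: subalgebra_def)
    have "eval ?Q ?\<rho> w = eval ?Q ?\<rho> w'"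
      if w: "w \<in> words ?F ?S" "w' \<in> words ?F ?S"
        and eq: "eval D (\<lambda>v. v) w = eval D (\<lambda>v. v) w'" for w w'
    proof -
      \<comment> \<open>Renaming letters by \<open>h\<close> turns words over \<open>C\<close> and
        \<open>a\<close> into words over \<open>G\<close> and \<open>h a\<close>, the words that the
        extension conditions concern. Words with equal values in \<open>D\<close> become words with
        equal values in \<open>E\<close>.\<close>
      let ?s = "subst (\<lambda>v. Var (h v))"
      have s: "?s t \<in> words ?F (insert (h a) (carrier G))"
        "eval E (\<lambda>v. v) (?s t) = h (eval D (\<lambda>v. v) t)"
        "eval ?Q ?r (?s t) = eval ?Q ?\<rho> t" if t: "t \<in> words ?F ?S" for t
      proof -
        show "?s t \<in> words ?F (insert (h a) (carrier G))"
          using t by (rule subst_in_words) (auto simp: Gc intro: words.Var)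
        show "eval E (\<lambda>v. v) (?s t) = h (eval D (\<lambda>v. v) t)"
          using hom_eval[OF hE Da t, of "\<lambda>v. v"] SD by (simp add: eval_subst)
        show "eval ?Q ?r (?s t) = eval ?Q ?\<rho> t" by (simp add: eval_subst)
      qed
      have "eval ?Q ?r (?s w) = eval ?Q ?r (?s w')"
        by (rule satisfies_conditions_eval[OF M Q' GQ se False b])
          (use s(1,2) w eq in simp_all)
      then show ?thesis using s(3) w by simp
    qed
    then obtain k where k: "hom ?F D ?Q k" "\<And>s. s \<in> ?S \<Longrightarrow> k s = ?\<rho> s"
      using hom_from_words[OF Dev Qa' \<rho>] by metis
    have "hom ?F D Q (\<lambda>d. projl (k d))" by (rule hom_comp[OF k(1) hom_copy(2)])
    moreover have "projl (k c) = g c" if "c \<in> carrier C" for c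
    proof -
      have "h c \<noteq> h a" using False Gc that by (metis imageI)
      then show ?thesis using k(2)[of c] hC that by simp
    qed
    ultimately show ?thesis by (intro exI[of _ "\<lambda>d. projl (k d)"]) auto
  qed
  then show thesis using that DB SD by blast
qed

section \<open>Graphs of partial homomorphisms and the maximality argument\<close>

text \<open>Partial homomorphisms from \<open>B\<close> to \<open>Q\<close> are represented by their graphs, ordered by
  inclusion.\<close>

definition hom_graph ::
    "'f signature \<Rightarrow> ('f, 'a) algebra \<Rightarrow> ('f, 'b) algebra \<Rightarrow> ('a \<times> 'b) set \<Rightarrow> bool" where
  "hom_graph F B Q R \<longleftrightarrow> R \<subseteq> carrier B \<times> carrier Q \<and> single_valued R \<and>
     (\<forall>f ps. (f, length ps) \<in> F \<and> set ps \<subseteq> R \<longrightarrow>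
        (opn B f (map fst ps), opn Q f (map snd ps)) \<in> R)"

lemma hom_graph_of_hom:
  assumes A: "subalgebra F A B" and g: "hom F A Q g"
  shows "hom_graph F B Q ((\<lambda>x. (x, g x)) ` carrier A)"
  unfolding hom_graph_def
proof (intro conjI allI impI)
  show "(\<lambda>x. (x, g x)) ` carrier A \<subseteq> carrier B \<times> carrier Q"
    using A g by (auto simp: subalgebra_def hom_def)
  show "single_valued ((\<lambda>x. (x, g x)) ` carrier A)" by (auto simp: single_valued_def)
  fix f ps assume *: "(f, length ps) \<in> F \<and> set ps \<subseteq> (\<lambda>x. (x, g x)) ` carrier A"
  then obtain xs where xs: "ps = map (\<lambda>x. (x, g x)) xs" "set xs \<subseteq> carrier A"
    using list_preimage by metis
  have "opn A f xs = opn B f xs" "opn A f xs \<in> carrier A"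
    using subalgebra_opn[OF A] opn_closed[of F A] A * xs by (simp_all add: subalgebra_def)
  moreover have "g (opn A f xs) = opn Q f (map g xs)"
    using hom_opn[OF g] * xs by simp
  ultimately show "(opn B f (map fst ps), opn Q f (map snd ps)) \<in> (\<lambda>x. (x, g x)) ` carrier A"
    using xs(1) by (force simp: comp_def)
qed

text \<open>Closure of \<open>R\<close> under the paired operations yields both halves: first
  components show that the domain is a subalgebra, second components that \<open>g\<close> respects
  the operations.\<close>

lemma hom_of_hom_graph:
  assumes B: "is_algebra F B" and R: "hom_graph F B Q R"
  obtains g where "subalgebra F (B\<lparr>carrier := Domain R\<rparr>) B"
    "hom F (B\<lparr>carrier := Domain R\<rparr>) Q g" "R = (\<lambda>x. (x, g x)) ` Domain R"
proof -
  have RBQ: "R \<subseteq> carrier B \<times> carrier Q" and sv: "single_valued R"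
    and cl: "\<And>f ps. (f, length ps) \<in> F \<Longrightarrow> set ps \<subseteq> R \<Longrightarrow>
      (opn B f (map fst ps), opn Q f (map snd ps)) \<in> R"
    using R by (auto simp: hom_graph_def)
  define g where "g x = (THE y. (x, y) \<in> R)" for x
  have gR: "g x = y" if "(x, y) \<in> R" for x y
    unfolding g_def using that sv by (auto simp: single_valued_def)
  then have graph: "R = (\<lambda>x. (x, g x)) ` Domain R" by force
  have op: "(opn B f xs, opn Q f (map g xs)) \<in> R"
    if "(f, length xs) \<in> F" "set xs \<subseteq> Domain R" for f xs
    using cl[of f "map (\<lambda>x. (x, g x)) xs"] that gR by (force simp: comp_def)
  have "subalgebra F (B\<lparr>carrier := Domain R\<rparr>) B"
    using RBQ op by (intro subalgebra_restrict[OF B]) (auto intro: DomainI)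
  moreover have "hom F (B\<lparr>carrier := Domain R\<rparr>) Q g"
    unfolding hom_def using gR op RBQ by (fastforce simp: image_subset_iff)
  ultimately show thesis using that graph by blast
qed

text \<open>Operations are finitary, so any finite set of pairs that a condition involves lies in a
  single member of the chain. Nonemptiness supplies such a member also for the empty argument list
  of a constant.\<close>

lemma hom_graph_Union:
  assumes ne: "\<C> \<noteq> {}" and ch: "subset.chain {R. hom_graph F B Q R} \<C>"
  shows "hom_graph F B Q (\<Union>\<C>)"
  unfolding hom_graph_def
proof (intro conjI allI impI)
  have hg: "hom_graph F B Q R" if "R \<in> \<C>" for R
    using ch that by (auto simp: subset.chain_def)
  show "\<Union>\<C> \<subseteq> carrier B \<times> carrier Q" using hg by (fastforce simp: hom_graph_def)
  have in_one: "\<exists>R \<in> \<C>. X \<subseteq> R" if "finite X" "X \<subseteq> \<Union>\<C>" for X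
    using finite_subset_Union_chain[OF that ne ch] by blast
  show "single_valued (\<Union>\<C>)"
  proof (rule single_valuedI)
    fix x y z assume "(x, y) \<in> \<Union>\<C>" "(x, z) \<in> \<Union>\<C>"
    then obtain R where "R \<in> \<C>" "{(x, y), (x, z)} \<subseteq> R"
      using in_one[of "{(x, y), (x, z)}"] by auto
    then show "y = z" using hg[of R] unfolding hom_graph_def single_valued_def by blast
  qed
  fix f ps assume *: "(f, length ps) \<in> F \<and> set ps \<subseteq> \<Union>\<C>"
  then obtain R where "R \<in> \<C>" "set ps \<subseteq> R" using in_one[of "set ps"] by auto
  then show "(opn B f (map fst ps), opn Q f (map snd ps)) \<in> \<Union>\<C>"
    using * hg[of R] unfolding hom_graph_def by blast
qed

theorem mainTheorem2:
  fixes M :: "'f variety" and B1 :: "('f, 'b) algebra"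
  assumes "is_variety M"
    and "CEP (sig M) (algebras M :: ('f, 'c) algebra set)"
    and "B1 \<in> algebras M"
    and "complete M B1"
  shows "injective TYPE('c) M B1"
  unfolding injective_def
proof (intro conjI ballI allI impI)
  let ?F = "sig M"
  fix B A :: "('f, 'c) algebra" and f
  assume B: "B \<in> algebras M" and A: "A \<in> algebras M" "subalgebra ?F A B"
    and f: "hom ?F A B1 f"
  have Ba: "is_algebra ?F B" using B by (simp add: algebras_def)
  define G where "G = (\<lambda>x. (x, f x)) ` carrier A"
  define \<R> where "\<R> = {R. hom_graph ?F B B1 R \<and> G \<subseteq> R}"
  have "G \<in> \<R>" using hom_graph_of_hom[OF A(2) f] by (simp add: \<R>_def G_def)
  moreover have "\<Union>\<C> \<in> \<R>" if "\<C> \<noteq> {}" "subset.chain \<R> \<C>" for \<C>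
  proof -
    have "subset.chain {R. hom_graph ?F B B1 R} \<C>"
      using that(2) by (auto simp: subset.chain_def \<R>_def)
    then have "hom_graph ?F B B1 (\<Union>\<C>)" by (rule hom_graph_Union[OF that(1)])
    moreover have "G \<subseteq> \<Union>\<C>" using that by (force simp: subset.chain_def \<R>_def)
    ultimately show ?thesis by (simp add: \<R>_def)
  qed
  ultimately obtain R where R: "R \<in> \<R>" and max: "\<And>X. X \<in> \<R> \<Longrightarrow> R \<subseteq> X \<Longrightarrow> X = R"
    using subset_Zorn_nonempty[of \<R>] by blast
  have hgR: "hom_graph ?F B B1 R" and GR: "G \<subseteq> R" using R by (auto simp: \<R>_def)
  define C where "C = B\<lparr>carrier := Domain R\<rparr>"
  have Cc: "carrier C = Domain R" by (simp add: C_def)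
  obtain g where CB: "subalgebra ?F C B" and g: "hom ?F C B1 g"
    and Rg: "R = (\<lambda>x. (x, g x)) ` Domain R"
    using hom_of_hom_graph[OF Ba hgR, folded C_def] .
  \<comment> \<open>If the domain of \<open>R\<close> is empty, then so is \<open>A\<close>, because
    \<open>G\<close> is contained in \<open>R\<close>; membership of \<open>A\<close> in the variety
    then allows the empty algebra.\<close>
  have Calg: "C \<in> algebras M"
    by (rule subalgebra_in_algebras[OF assms(1) CB B])
      (use A(1) GR in \<open>auto simp: algebras_def G_def Cc\<close>)
  have total: "a \<in> carrier C" if a: "a \<in> carrier B" for a
  proof -
    obtain D k where D: "subalgebra ?F D B" "insert a (carrier C) \<subseteq> carrier D"
      "hom ?F D B1 k" "\<And>c. c \<in> carrier C \<Longrightarrow> k c = g c"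
      using hom_extension_step[OF assms B Calg CB g a] by metis
    \<comment> \<open>The graph of the extension to \<open>D\<close> contains \<open>R\<close>, so
      by maximality it equals \<open>R\<close>, and \<open>a\<close> already lies in the domain of
      \<open>R\<close>.\<close>
    let ?X = "(\<lambda>x. (x, k x)) ` carrier D"
    have "R \<subseteq> ?X" using D(2,4) by (subst Rg) (force simp: Cc)
    moreover have "?X \<in> \<R>"
      using hom_graph_of_hom[OF D(1,3)] GR \<open>R \<subseteq> ?X\<close> by (auto simp: \<R>_def)
    ultimately have "?X = R" using max by blast
    then show ?thesis using D(2) by (force simp: Cc)
  qed
  have "hom ?F B B1 g"
    using g total CB unfolding hom_def C_def by (auto simp: image_subset_iff subset_iff)
  moreover have "g x = f x" if "x \<in> carrier A" for x
  proof -
    have "(x, f x) \<in> R" using GR that by (auto simp: G_def)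
    then show ?thesis by (subst (asm) Rg) auto
  qed
  ultimately show "\<exists>g. hom ?F B B1 g \<and> (\<forall>x \<in> carrier A. g x = f x)" by blast
qed (rule assms(3))

end
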